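(* Let $d\ge 2$ and $\mathbf{k}=(k_1,\dots,k_d)\in\mathbb{N}_0^d$, and let $\mathcal{B}_{\mathbf{k}}=\{\mathbf{h}\in\mathbb{N}_0^d:\mathbf{h}\le\mathbf{k}\}$. Then $$n_A^*(\mathcal{B}_{\mathbf{k}})=(2k_1+1)\cdots(2k_d+1).$$
   Context: $\mathbf{h}\le\mathbf{k}$ is understood component-wise. For $n\in\mathbb{N}=\{1,2,\dots\}$, $a\equiv_n b$ means $a\equiv b\pmod n$. The mirrored set $\mathcal{M}(\Lambda)$ of $\Lambda\subset\mathbb{N}_0^d$ is the set of all vectors of $\mathbb{Z}^d$ obtained from elements of $\Lambda$ by arbitrary component-wise sign changes. A pair $(n,\mathbf{z})\in\mathbb{N}\times\mathbb{Z}^d$ is admissible for Plan A for $\Lambda$ if $\mathbf{h}\cdot\mathbf{z}\not\equiv_n\mathbf{h}'\cdot\mathbf{z}$ for all $\mathbf{h}\ne\mathbf{h}'\in\mathcal{M}(\Lambda)$. $n_A^*(\Lambda)$ is the smallest $n\in\mathbb{N}$ such that $(n,\mathbf{z})$ is admissible for Plan A for $\Lambda$ for some $\mathbf{z}\in\mathbb{Z}^d$. *)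

theory Defs
  imports "HOL-Analysis.Analysis" "HOL-Number_Theory.Cong"
begin

text \<open>Vectors of $d$ components are indexed by a finite type of cardinality $d$.\<close>

definition int_dot :: "int ^ 'd \<Rightarrow> int ^ 'd \<Rightarrow> int" where
  "int_dot h z = (\<Sum>i\<in>UNIV. h $ i * z $ i)"

definition mirrored_set :: "(nat ^ 'd) set \<Rightarrow> (int ^ 'd) set" where
  "mirrored_set \<Lambda> =
     {(\<chi> i. s $ i * int (h $ i)) | h s. h \<in> \<Lambda> \<and> (\<forall>i. s $ i \<in> {-1, 1 :: int})}"

definition admissible_A :: "(nat ^ 'd) set \<Rightarrow> nat \<Rightarrow> int ^ 'd \<Rightarrow> bool" where
  "admissible_A \<Lambda> n z \<longleftrightarrow>
     n \<ge> 1 \<and>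
     (\<forall>h\<in>mirrored_set \<Lambda>. \<forall>h'\<in>mirrored_set \<Lambda>. h \<noteq> h' \<longrightarrow>
        \<not> [int_dot h z = int_dot h' z] (mod int n))"

text \<open>For infinite \<open>\<Lambda>\<close> no admissible pair exists and the value is unspecified.\<close>

definition n_star_A :: "(nat ^ 'd) set \<Rightarrow> nat" where
  "n_star_A \<Lambda> = (LEAST n. \<exists>z. admissible_A \<Lambda> n z)"

text \<open>The order on vectors is component-wise, see \<open>less_eq_vec_def\<close>.\<close>

definition box_set :: "nat ^ 'd \<Rightarrow> (nat ^ 'd) set" where
  "box_set k = {h. h \<le> k}"

end

(* The mirrored box is the set of integer points with |x_i| <= k_i, so it has
   (2k_1+1)...(2k_d+1) elements, and admissibility of (n, z) means that h |-> h.z mod n is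
   injective on it; hence n is at least that product. Conversely the mixed-radix vector
   z = (1, m_1, m_1 m_2, ...) with m_i = 2k_i+1 attains it: differences w of points in the box
   satisfy |w_i| < m_i, and w.z = 0 mod m_1...m_d forces the digits w_i to vanish one by one. *)
theory Submission imports Defs begin

lemma mirrored_set_box_set:
  fixes k :: "nat ^ 'd"
  shows "mirrored_set (box_set k) = {x. \<forall>i. \<bar>x $ i\<bar> \<le> int (k $ i)}"
proof (intro set_eqI iffI)
  fix x assume "x \<in> mirrored_set (box_set k)"
  then obtain h s where x: "x = (\<chi> i. s $ i * int (h $ i))" and "h \<le> k"
    and s: "\<And>i. s $ i \<in> {-1, 1 :: int}"
    by (auto simp: mirrored_set_def box_set_def)
  have "\<bar>x $ i\<bar> \<le> int (k $ i)" for i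
    using s[of i] \<open>h \<le> k\<close> by (auto simp: x less_eq_vec_def)
  then show "x \<in> {x. \<forall>i. \<bar>x $ i\<bar> \<le> int (k $ i)}" by simp
next
  fix x :: "int ^ 'd" assume x: "x \<in> {x. \<forall>i. \<bar>x $ i\<bar> \<le> int (k $ i)}"
  define h :: "nat ^ 'd" where "h = (\<chi> i. nat \<bar>x $ i\<bar>)"
  \<comment> \<open>Zero components get the sign 1, since \<open>s\<close> must avoid the value 0
    that \<open>sgn\<close> would give there.\<close>
  define s :: "int ^ 'd" where "s = (\<chi> i. if x $ i < 0 then -1 else 1)"
  have "x = (\<chi> i. s $ i * int (h $ i))"
    by (auto simp: vec_eq_iff h_def s_def)
  moreover have "h \<in> box_set k"
    using x by (auto simp: box_set_def less_eq_vec_def h_def nat_le_iff)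
  moreover have "\<forall>i. s $ i \<in> {-1, 1}" by (simp add: s_def)
  ultimately show "x \<in> mirrored_set (box_set k)"
    unfolding mirrored_set_def by blast
qed

text \<open>Via \<open>vec_lambda\<close>, the mirrored box is a copy of a product of integer
  intervals, the one at \<open>i\<close> having \<open>2 * k $ i + 1\<close> elements.\<close>

lemma card_mirrored_box_set:
  fixes k :: "nat ^ 'd"
  shows "card (mirrored_set (box_set k)) = (\<Prod>i\<in>UNIV. 2 * k $ i + 1)"
proof -
  let ?P = "PiE UNIV (\<lambda>i. {- int (k $ i)..int (k $ i)})"
  have "x \<in> vec_lambda ` ?P" if "\<forall>i. \<bar>x $ i\<bar> \<le> int (k $ i)" for x
  proof
    show "x = vec_lambda (\<lambda>i. x $ i)" by simp
    show "(\<lambda>i. x $ i) \<in> ?P" using that by (auto simp: abs_le_iff minus_le_iff)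
  qed
  then have "mirrored_set (box_set k) = vec_lambda ` ?P"
    by (auto simp: mirrored_set_box_set abs_le_iff PiE_iff minus_le_iff)
  moreover have "inj_on vec_lambda ?P" by (simp add: inj_on_def vec_lambda_inject)
  ultimately have "card (mirrored_set (box_set k)) = card ?P" by (simp add: card_image)
  also have "\<dots> = (\<Prod>i\<in>UNIV. 2 * k $ i + 1)"
    by (auto simp: card_PiE nat_add_distrib intro!: prod.cong)
  finally show ?thesis .
qed

text \<open>Pigeonhole on the \<open>n\<close> residues modulo \<open>n\<close>, for arbitrary
  \<open>\<Lambda>\<close>.\<close>

lemma card_mirrored_set_le_if_admissible_A:
  assumes "admissible_A \<Lambda> n z"
  shows "card (mirrored_set \<Lambda>) \<le> n"
proof -
  have "inj_on (\<lambda>h. int_dot h z mod int n) (mirrored_set \<Lambda>)"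
    using assms by (auto simp: admissible_A_def inj_on_def cong_def)
  \<comment> \<open>The clause \<open>n \<ge> 1\<close> of admissibility enters here: reduction
    \<open>mod 0\<close> would be the identity.\<close>
  moreover have "(\<lambda>h. int_dot h z mod int n) ` mirrored_set \<Lambda> \<subseteq> {0..<int n}"
    using assms by (auto simp: admissible_A_def)
  ultimately have "card (mirrored_set \<Lambda>) \<le> card {0..<int n}"
    by (rule card_inj_on_le) simp
  then show ?thesis by simp
qed

text \<open>Induction on \<open>S\<close> builds the weights without ordering the index type. The
  \<open>w i\<close> stand for differences of digits, hence the two-sided bound.\<close>

lemma mixed_radix_separation:
  fixes m :: "'i \<Rightarrow> int"
  assumes "finite S" and pos: "\<And>i. m i > 0"
  shows "\<exists>z. \<forall>w. (\<forall>i\<in>S. \<bar>w i\<bar> < m i) \<and> (\<Prod>i\<in>S. m i) dvd (\<Sum>i\<in>S. w i * z i)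
           \<longrightarrow> (\<forall>i\<in>S. w i = 0)"
  using assms(1)
proof (induction S)
  case empty
  show ?case by simp
next
  case (insert j S)
  then obtain z where z: "\<And>w. \<forall>i\<in>S. \<bar>w i\<bar> < m i \<Longrightarrow>
      (\<Prod>i\<in>S. m i) dvd (\<Sum>i\<in>S. w i * z i) \<Longrightarrow> \<forall>i\<in>S. w i = 0" by blast
  \<comment> \<open>The new index \<open>j\<close> becomes the least significant digit: it gets
    weight 1, and all earlier weights are scaled by its radix \<open>m j\<close>.\<close>
  define z' where "z' = (\<lambda>i. if i = j then 1 else m j * z i)"
  have "\<forall>i\<in>insert j S. w i = 0"
    if w: "\<forall>i\<in>insert j S. \<bar>w i\<bar> < m i"
      and dvd: "(\<Prod>i\<in>insert j S. m i) dvd (\<Sum>i\<in>insert j S. w i * z' i)" for w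
  proof -
    have "(\<Sum>i\<in>S. w i * z' i) = m j * (\<Sum>i\<in>S. w i * z i)"
      using insert.hyps unfolding sum_distrib_left by (auto simp: z'_def intro!: sum.cong)
    then have dvd': "m j * (\<Prod>i\<in>S. m i) dvd w j + m j * (\<Sum>i\<in>S. w i * z i)"
      using dvd insert.hyps by (simp add: z'_def)
    \<comment> \<open>Modulo \<open>m j\<close> only the term \<open>w j\<close> survives. A nonzero
      multiple of \<open>m j\<close> would have absolute value at least \<open>m j\<close>, against
      the bound on \<open>w j\<close>.\<close>
    then have "m j dvd w j" by (metis dvd_add_left_iff dvd_mult_left dvd_triv_left)
    then have "w j = 0" using w by (metis dvd_imp_le_int insertI1 abs_of_pos pos not_less)
    \<comment> \<open>With \<open>w j = 0\<close>, the positive factor \<open>m j\<close> cancels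
      from the divisibility, leaving the premise of the induction hypothesis.\<close>
    moreover have "\<forall>i\<in>S. w i = 0"
      using w dvd' \<open>w j = 0\<close> pos[of j] by (intro z) auto
    ultimately show ?thesis by simp
  qed
  then show ?case by blast
qed

lemma admissible_A_box_set:
  fixes k :: "nat ^ 'd"
  shows "\<exists>z. admissible_A (box_set k) (\<Prod>i\<in>UNIV. 2 * k $ i + 1) z"
proof -
  define m where "m i = 2 * int (k $ i) + 1" for i
  let ?n = "\<Prod>i\<in>UNIV. 2 * k $ i + 1"
  have n: "int ?n = (\<Prod>i\<in>UNIV. m i)" by (simp add: m_def add.commute)
  have "\<And>i. m i > 0" by (simp add: m_def)
  then obtain z where z: "\<And>w. \<forall>i. \<bar>w i\<bar> < m i \<Longrightarrow>
      (\<Prod>i\<in>UNIV. m i) dvd (\<Sum>i\<in>UNIV. w i * z i) \<Longrightarrow> \<forall>i. w i = 0"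
    using mixed_radix_separation[of UNIV m] by simp blast
  have "h = h'" if h: "h \<in> mirrored_set (box_set k)" "h' \<in> mirrored_set (box_set k)"
    and cong: "[int_dot h (vec_lambda z) = int_dot h' (vec_lambda z)] (mod int ?n)" for h h'
  proof -
    \<comment> \<open>Two integers in an interval from \<open>-k $ i\<close> to \<open>k $ i\<close>
      differ by at most \<open>2 * k $ i\<close>, one less than \<open>m i\<close>.\<close>
    have "\<bar>h $ i - h' $ i\<bar> < m i" for i
    proof -
      have "\<bar>h $ i\<bar> \<le> int (k $ i)" "\<bar>h' $ i\<bar> \<le> int (k $ i)"
        using h by (simp_all add: mirrored_set_box_set)
      then show ?thesis by (simp add: m_def)
    qed
    moreover have "(\<Prod>i\<in>UNIV. m i) dvd (\<Sum>i\<in>UNIV. (h $ i - h' $ i) * z i)"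
      using cong unfolding n cong_iff_dvd_diff
      by (simp add: int_dot_def left_diff_distrib sum_subtractf)
    ultimately have "\<forall>i. h $ i - h' $ i = 0" by (intro z) simp_all
    then show ?thesis by (simp add: vec_eq_iff)
  qed
  moreover have "?n \<ge> 1" by (simp add: Suc_le_eq prod_pos)
  ultimately show ?thesis unfolding admissible_A_def by blast
qed

theorem mainTheorem2:
  fixes k :: "nat ^ 'd"
  assumes "CARD('d) \<ge> 2"
  shows "n_star_A (box_set k) = (\<Prod>i\<in>UNIV. 2 * k $ i + 1)"
  unfolding n_star_A_def
proof (rule Least_equality)
  show "\<exists>z. admissible_A (box_set k) (\<Prod>i\<in>UNIV. 2 * k $ i + 1) z"
    by (rule admissible_A_box_set)
  show "(\<Prod>i\<in>UNIV. 2 * k $ i + 1) \<le> n" if "\<exists>z. admissible_A (box_set k) n z" for n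
    using that card_mirrored_set_le_if_admissible_A card_mirrored_box_set by metis
qed

end
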